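(* Let $\nabla$ be the covariant derivative on $\Omega^1C(S_3)$ with parameters $a,b,c,d,e\in\mathbb C$ given by $\hat\Gamma^x_{xx}=a-1$, $\hat\Gamma^x_{yz}=c$, $\hat\Gamma^x_{yx}=d-1$, $\hat\Gamma^x_{xy}=e$, $\hat\Gamma^y_{xx}=b$ ($x,y,z$ distinct transpositions). The moduli space of such $\nabla$ which are torsion free, cotorsion free (for the Euclidean metric) and star compatible has one continuous parameter $r\in[\frac13,\frac23]$, and consists of the connections with $d=c$, $e=c-1$ and $$a=\frac{e^{\imath\phi}}{\sqrt{1+8\cos^2(\theta-\phi)}},\quad b=-\frac{e^{\imath\theta}\,2\cos(\theta-\phi)}{\sqrt{1+8\cos^2(\theta-\phi)}},\quad c=\frac{2e^{\imath\psi}\cos\psi}{3},$$ with $|\theta-\phi|,|\psi|\le\frac\pi2$, where $$\cos\theta=\frac{1+3r^2}{4r},\qquad\cos(\theta-\phi)=\frac{r}{2\sqrt{1-2r^2}},\qquad\cos\psi=\sqrt{\tfrac98(1-r^2)},$$ with free choices for the signs of $\theta$, $\psi$, $\theta-\phi$.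
   Context: Let $A=C(S_3)$, the algebra of complex functions on the permutation group $S_3$ with $f^*=\bar f$, and let $C\subset S_3$ be the set of the three transpositions. $\Omega^1A$ is the free left $A$-module with basis $\xi^x$, $x\in C$, with $\xi^xf=R_x(f)\xi^x$ where $R_x(f)(g)=f(gx)$, $\mathrm df=\sum_{x\in C}(R_xf-f)\xi^x$, and star $(\xi^x)^*=-\xi^x$, $(f\xi)^*=\xi^*f^*$. $\Omega^2A$ is $\Omega^1A\otimes_A\Omega^1A$ modulo $\ker(\mathrm{id}-\Psi)$, where $\Psi(\xi^x\otimes\xi^y)=\xi^{xyx^{-1}}\otimes\xi^x$ is extended as a bimodule map; labelling the transpositions $1,2,3$, the relations are $\xi^i\wedge\xi^i=0$, $\xi^1\wedge\xi^2+\xi^2\wedge\xi^3+\xi^3\wedge\xi^1=0$, $\xi^2\wedge\xi^1+\xi^3\wedge\xi^2+\xi^1\wedge\xi^3=0$. With $\vartheta=\sum_x\xi^x$, $\mathrm d\xi^x=\vartheta\wedge\xi^x+\xi^x\wedge\vartheta$. The connection is $\nabla\xi^x=-\sum_{y,z\in C}\hat\Gamma^x_{yz}\,\xi^y\otimes\xi^z$, extended by $\nabla(f\xi)=\mathrm df\otimes\xi+f\nabla\xi$. It is a bimodule covariant derivative, i.e. $\nabla(\xi f)=\nabla(\xi)f+\sigma(\xi\otimes\mathrm df)$ with the bimodule map $\sigma$ on $\Omega^1A\otimes_A\Omega^1A$ given by $\sigma(\xi^u\otimes\xi^v)=\sum_{y,z\in C,\ yz=uv}(\hat\Gamma^u_{yz}+\delta_{u,z})\,\xi^y\otimes\xi^z$.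 Torsion is $T=\wedge\nabla-\mathrm d$; torsion free means $T=0$. Star compatible means $\sigma$ is invertible and $\sigma\tau\sigma=\tau$ with $\tau(\xi\otimes\eta)=\eta^*\otimes\xi^*$. The Euclidean metric is the Hermitian metric $\langle\xi^x,\overline{\xi^y}\rangle=\lambda\delta_{x,y}$, $\lambda>0$ constant. With $\Gamma^x_z=\sum_y\hat\Gamma^x_{yz}\xi^y$, cotorsion free for this metric means $\sum_{z\in C}\big(\Gamma^x_z+(\Gamma^z_x)^*\big)\wedge\xi^z=0$ in $\Omega^2A$ for all $x\in C$ (this is the vanishing of the wedge product of the last two factors of the covariant derivative of the inverse metric element $\sum_x\overline{\xi^x}\otimes\xi^x$).
   Formalization: The signs of θ and ψ are not both free: torsion and cotorsion freeness force b = c−1, so for r > 1/3 the signs of θ and ψ must be opposite; this condition (sin θ sin ψ ≤ 0) is added. The sign of θ−φ stays free. *)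

theory Defs
  imports
    Complex_Main
    "HOL-Library.Function_Algebras"
    "HOL-Library.Numeral_Type"
    "HOL-Combinatorics.Perm"
begin

section \<open>The group and the algebra of functions\<close>

text \<open>\<^typ>\<open>3 perm\<close> is the group of all permutations of a three-element type, with composition
  as multiplication.\<close>

type_synonym S3 = "3 perm"

typedef transposition = "{x :: S3. \<exists>i j. i \<noteq> j \<and> x = Perm.swap i j}"
  morphisms perm_of Abs_transposition
proof -
  have "(0::3) \<noteq> 1" by simp
  then show ?thesis by blast
qed

setup_lifting type_definition_transposition

instance transposition :: finite
proof
  have "range perm_of \<subseteq> (\<lambda>(i, j). Perm.swap i j) ` (UNIV :: (3 \<times> 3) set)"
  proof
    fix x assume "x \<in> range perm_of"
    then have "\<exists>i j. i \<noteq> j \<and> x = Perm.swap i j" using perm_of by auto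
    then show "x \<in> (\<lambda>(i, j). Perm.swap i j) ` UNIV" by auto
  qed
  then have "finite (range perm_of)"
    by (rule finite_subset) simp
  then show "finite (UNIV :: transposition set)"
    by (rule finite_imageD) (simp add: inj_on_def perm_of_inject)
qed

type_synonym alg = "S3 \<Rightarrow> complex"

definition const :: "complex \<Rightarrow> alg"
  where "const k = (\<lambda>g. k)"

definition star0 :: "alg \<Rightarrow> alg"
  where "star0 f = (\<lambda>g. cnj (f g))"

definition R :: "transposition \<Rightarrow> alg \<Rightarrow> alg"
  where "R x f = (\<lambda>g. f (g * perm_of x))"


section \<open>One-forms\<close>

text \<open>A one-form is given by its left coefficients: \<open>\<eta>\<close> stands for \<open>\<Sum>x. \<eta> x \<xi>\<^sup>x\<close>.\<close>

type_synonym form1 = "transposition \<Rightarrow> alg"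

definition xi :: "transposition \<Rightarrow> form1"
  where "xi x = (\<lambda>y. if y = x then 1 else 0)"

definition lmul :: "alg \<Rightarrow> form1 \<Rightarrow> form1"
  where "lmul f \<eta> = (\<lambda>x. f * \<eta> x)"

text \<open>\<open>(\<Sum>x. \<eta> x \<xi>\<^sup>x) f = \<Sum>x. \<eta> x R\<^sub>x(f) \<xi>\<^sup>x\<close>\<close>

definition rmul :: "form1 \<Rightarrow> alg \<Rightarrow> form1"
  where "rmul \<eta> f = (\<lambda>x. \<eta> x * R x f)"

definition d0 :: "alg \<Rightarrow> form1"
  where "d0 f = (\<Sum>x\<in>UNIV. lmul (R x f - f) (xi x))"

definition star1 :: "form1 \<Rightarrow> form1"
  where "star1 \<eta> = (\<Sum>x\<in>UNIV. rmul (- xi x) (star0 (\<eta> x)))"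


section \<open>The tensor square of the one-forms\<close>

text \<open>The tensor square over \<^typ>\<open>alg\<close> is the free left module on \<open>\<xi>\<^sup>x \<otimes> \<xi>\<^sup>y\<close>, again given by left
  coefficients, with \<open>f \<xi>\<^sup>x \<otimes> g \<xi>\<^sup>y = f R\<^sub>x(g) \<xi>\<^sup>x \<otimes> \<xi>\<^sup>y\<close>.\<close>

type_synonym tensor = "transposition \<Rightarrow> transposition \<Rightarrow> alg"

definition tens :: "form1 \<Rightarrow> form1 \<Rightarrow> tensor"
  where "tens \<eta> \<zeta> = (\<lambda>x y. \<eta> x * R x (\<zeta> y))"

definition lmul2 :: "alg \<Rightarrow> tensor \<Rightarrow> tensor"
  where "lmul2 f T = (\<lambda>x y. f * T x y)"

definition rmul2 :: "tensor \<Rightarrow> alg \<Rightarrow> tensor"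
  where "rmul2 T f = (\<lambda>x y. T x y * R x (R y f))"

lemma tens_balanced: "tens (rmul \<eta> f) \<zeta> = tens \<eta> (lmul f \<zeta>)"
  by (simp add: tens_def rmul_def lmul_def R_def fun_eq_iff)

lemma tens_lmul: "tens (lmul f \<eta>) \<zeta> = lmul2 f (tens \<eta> \<zeta>)"
  by (simp add: tens_def lmul2_def lmul_def fun_eq_iff mult.assoc)

lemma tens_rmul: "tens \<eta> (rmul \<zeta> f) = rmul2 (tens \<eta> \<zeta>) f"
  by (simp add: tens_def rmul2_def rmul_def R_def fun_eq_iff)


section \<open>Two-forms\<close>

lift_definition conj_by :: "transposition \<Rightarrow> transposition \<Rightarrow> transposition"
  is "\<lambda>x y. x * y * inverse x"
proof -
  fix x y :: S3
  assume "\<exists>i j. i \<noteq> j \<and> y = Perm.swap i j"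
  then obtain i j where y: "y = Perm.swap i j" and ij: "i \<noteq> j" by blast
  have "x * y = Perm.swap (Perm.apply x i) (Perm.apply x j) * x"
  proof (rule perm_eqI)
    fix a
    consider "a = i" | "a = j" | "a \<noteq> i" "a \<noteq> j" by blast
    then show "Perm.apply (x * y) a
      = Perm.apply (Perm.swap (Perm.apply x i) (Perm.apply x j) * x) a"
      by cases (simp_all add: y apply_times apply_inj)
  qed
  then have "x * y * inverse x = Perm.swap (Perm.apply x i) (Perm.apply x j)"
    by (simp add: mult.assoc)
  moreover have "Perm.apply x i \<noteq> Perm.apply x j" using ij by (simp add: apply_inj)
  ultimately show "\<exists>i j. i \<noteq> j \<and> x * y * inverse x = Perm.swap i j" by blast
qed

definition Psi :: "tensor \<Rightarrow> tensor"
  where "Psi T = (\<Sum>x\<in>UNIV. \<Sum>y\<in>UNIV. lmul2 (T x y) (tens (xi (conj_by x y)) (xi x)))"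

lemma Psi_diff: "Psi (S - T) = Psi S - Psi T"
proof -
  have "lmul2 ((S - T) x y) U = lmul2 (S x y) U - lmul2 (T x y) U" for x y U
    by (simp add: lmul2_def fun_eq_iff algebra_simps)
  then show ?thesis by (simp add: Psi_def sum_subtractf)
qed

lemma Psi_0: "Psi 0 = 0"
  using Psi_diff[of 0 0] by simp

lemma Psi_uminus: "Psi (- T) = - Psi T"
  using Psi_diff[of 0 T] by (simp add: Psi_0)

lemma Psi_add: "Psi (S + T) = Psi S + Psi T"
  using Psi_diff[of S "- T"] by (simp add: Psi_uminus)

text \<open>\<open>\<Omega>\<^sup>2 = (\<Omega>\<^sup>1 \<otimes> \<Omega>\<^sup>1) / ker (id - \<Psi>)\<close>, with \<open>wedge\<close> the quotient map.\<close>

quotient_type form2 = tensor / "\<lambda>S T. S - T - Psi (S - T) = 0"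
  morphisms rep_form2 wedge
proof (rule equivpI)
  show "reflp (\<lambda>S T. S - T - Psi (S - T) = 0)"
    by (simp add: reflp_def Psi_diff)
  show "symp (\<lambda>S T. S - T - Psi (S - T) = 0)"
    by (simp add: symp_def Psi_diff) (simp add: algebra_simps)
  show "Relation.transp (\<lambda>S T. S - T - Psi (S - T) = 0)"
  proof (rule transpI)
    fix S T U :: tensor
    assume "S - T - Psi (S - T) = 0" "T - U - Psi (T - U) = 0"
    then have "(S - T - Psi (S - T)) + (T - U - Psi (T - U)) = 0" by (simp only: add_0_left)
    then show "S - U - Psi (S - U) = 0" by (simp add: Psi_diff algebra_simps)
  qed
qed

instantiation form2 :: ab_group_add
begin

lift_definition zero_form2 :: form2 is 0 .

lift_definition plus_form2 :: "form2 \<Rightarrow> form2 \<Rightarrow> form2" is "(+)"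
proof -
  fix S S' T T' :: tensor
  assume "S - S' - Psi (S - S') = 0" "T - T' - Psi (T - T') = 0"
  then have "(S - S' - Psi (S - S')) + (T - T' - Psi (T - T')) = 0" by (simp only: add_0_left)
  then show "S + T - (S' + T') - Psi (S + T - (S' + T')) = 0"
    by (simp add: Psi_diff Psi_add algebra_simps)
qed

lift_definition uminus_form2 :: "form2 \<Rightarrow> form2" is uminus
proof -
  fix S T :: tensor
  assume "S - T - Psi (S - T) = 0"
  then have "- (S - T - Psi (S - T)) = 0" by (simp only: minus_zero)
  then show "- S - - T - Psi (- S - - T) = 0"
    by (simp add: Psi_diff Psi_uminus Psi_add algebra_simps)
qed

lift_definition minus_form2 :: "form2 \<Rightarrow> form2 \<Rightarrow> form2" is "(-)"
proof -
  fix S S' T T' :: tensor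
  assume "S - S' - Psi (S - S') = 0" "T - T' - Psi (T - T') = 0"
  then have "(S - S' - Psi (S - S')) - (T - T' - Psi (T - T')) = 0" by (simp only: diff_self)
  then show "S - T - (S' - T') - Psi (S - T - (S' - T')) = 0"
    by (simp add: Psi_diff Psi_add algebra_simps)
qed

instance
  by standard (transfer; simp add: Psi_diff Psi_add Psi_0 Psi_uminus algebra_simps)+

end

definition theta :: form1
  where "theta = (\<Sum>x\<in>UNIV. xi x)"

text \<open>\<open>d (f \<xi>\<^sup>x) = df \<and> \<xi>\<^sup>x + f (\<theta> \<and> \<xi>\<^sup>x + \<xi>\<^sup>x \<and> \<theta>)\<close>\<close>

definition d1 :: "form1 \<Rightarrow> form2"
  where "d1 \<eta> = (\<Sum>x\<in>UNIV. wedge (tens (d0 (\<eta> x)) (xi x))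
    + wedge (lmul2 (\<eta> x) (tens theta (xi x) + tens (xi x) theta)))"


section \<open>Connections with constant coefficients\<close>

text \<open>\<open>G x y z\<close> is the coefficient of \<open>\<xi>\<^sup>y \<otimes> \<xi>\<^sup>z\<close> in \<open>-\<nabla> \<xi>\<^sup>x\<close>.\<close>

type_synonym christoffel = "transposition \<Rightarrow> transposition \<Rightarrow> transposition \<Rightarrow> complex"

definition nabla_xi :: "christoffel \<Rightarrow> transposition \<Rightarrow> tensor"
  where "nabla_xi G x = - (\<Sum>y\<in>UNIV. \<Sum>z\<in>UNIV. lmul2 (const (G x y z)) (tens (xi y) (xi z)))"

definition nabla :: "christoffel \<Rightarrow> form1 \<Rightarrow> tensor"
  where "nabla G \<eta> = (\<Sum>x\<in>UNIV. tens (d0 (\<eta> x)) (xi x) + lmul2 (\<eta> x) (nabla_xi G x))"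

definition sigma_xi :: "christoffel \<Rightarrow> transposition \<Rightarrow> transposition \<Rightarrow> tensor"
  where "sigma_xi G u v =
    (\<Sum>(y, z) \<in> {(y, z). perm_of y * perm_of z = perm_of u * perm_of v}.
      lmul2 (const (G u y z + (if u = z then 1 else 0))) (tens (xi y) (xi z)))"

definition sigma :: "christoffel \<Rightarrow> tensor \<Rightarrow> tensor"
  where "sigma G T = (\<Sum>u\<in>UNIV. \<Sum>v\<in>UNIV. lmul2 (T u v) (sigma_xi G u v))"

text \<open>The map \<open>\<tau>(\<eta> \<otimes> \<zeta>) = \<zeta>\<^sup>* \<otimes> \<eta>\<^sup>*\<close>, evaluated on \<open>\<Sum>u v. T u v \<xi>\<^sup>u \<otimes> \<xi>\<^sup>v\<close>; see \<open>tau_tens\<close>.\<close>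

definition tau :: "tensor \<Rightarrow> tensor"
  where "tau T = (\<Sum>u\<in>UNIV. \<Sum>v\<in>UNIV. tens (star1 (xi v)) (star1 (lmul (T u v) (xi u))))"

definition torsion :: "christoffel \<Rightarrow> form1 \<Rightarrow> form2"
  where "torsion G \<eta> = wedge (nabla G \<eta>) - d1 \<eta>"

definition torsion_free :: "christoffel \<Rightarrow> bool"
  where "torsion_free G \<longleftrightarrow> (\<forall>\<eta>. torsion G \<eta> = 0)"

definition star_compatible :: "christoffel \<Rightarrow> bool"
  where "star_compatible G \<longleftrightarrow> bij (sigma G) \<and> sigma G \<circ> tau \<circ> sigma G = tau"

definition Gamma :: "christoffel \<Rightarrow> transposition \<Rightarrow> transposition \<Rightarrow> form1"
  where "Gamma G x z = (\<Sum>y\<in>UNIV. lmul (const (G x y z)) (xi y))"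

text \<open>Cotorsion freeness for the Euclidean Hermitian metric, which pairs \<open>\<xi>\<^sup>x\<close> with the conjugate of
  \<open>\<xi>\<^sup>y\<close> to \<open>\<lambda> \<delta>\<close>: the wedge product of the last two factors of the covariant derivative of the inverse
  metric vanishes. The constant \<open>\<lambda> > 0\<close> only rescales the inverse metric and drops out.\<close>

definition cotorsion_free :: "christoffel \<Rightarrow> bool"
  where "cotorsion_free G \<longleftrightarrow>
    (\<forall>x. (\<Sum>z\<in>UNIV. wedge (tens (Gamma G x z + star1 (Gamma G z x)) (xi z))) = 0)"


section \<open>Consistency of the coordinate formulas\<close>

lemma sum_form1_apply: "sum F A x = (\<Sum>i\<in>A. F i x)" for F :: "'i \<Rightarrow> form1"
  by (induction A rule: infinite_finite_induct) simp_all

lemma sum_tensor_apply: "sum F A x y = (\<Sum>i\<in>A. F i x y)" for F :: "'i \<Rightarrow> tensor"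
  by (induction A rule: infinite_finite_induct) simp_all

lemma sum_delta_mult:
  "(\<Sum>x\<in>(UNIV::transposition set). F x * (if z = x then 1 else 0)) = F z" for F :: form1
proof -
  have "(\<Sum>x\<in>UNIV. F x * (if z = x then 1 else 0)) = (\<Sum>x\<in>UNIV. if z = x then F x else 0)"
    by (rule sum.cong) auto
  then show ?thesis by simp
qed

lemma R_R: "R x (R y f) = (\<lambda>g. f (g * (perm_of x * perm_of y)))"
  by (simp add: R_def fun_eq_iff mult.assoc)

lemma perm_of_square: "perm_of x * perm_of x = 1"
  using perm_of[of x] by auto

lemma star1_apply: "star1 \<eta> x = - R x (star0 (\<eta> x))"
proof -
  have "star1 \<eta> x = (\<Sum>y\<in>UNIV. - R x (star0 (\<eta> y)) * (if x = y then 1 else 0))"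
    unfolding star1_def sum_form1_apply
    by (rule sum.cong) (auto simp: rmul_def xi_def)
  then show ?thesis by (simp only: sum_delta_mult)
qed

lemma tau_apply: "tau T x y = R x (R y (star0 (T y x)))"
proof -
  have eq: "tens (star1 (xi v)) (star1 (lmul f (xi u))) x y
      = (if x = v then if y = u then R x (R y (star0 f)) else 0 else 0)" for u v f
    by (auto simp: tens_def star1_apply R_def lmul_def xi_def star0_def fun_eq_iff)
  show ?thesis
    by (simp add: tau_def sum_tensor_apply eq)
qed

lemma tau_tens: "tau (tens \<eta> \<zeta>) = tens (star1 \<zeta>) (star1 \<eta>)"
proof -
  have "g * perm_of x * perm_of y * perm_of y = g * perm_of x" for g x y
    by (simp add: mult.assoc perm_of_square)
  then show ?thesis
    by (auto simp: tau_apply tens_def star1_apply R_def star0_def fun_eq_iff)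
qed

lemma d0_apply: "d0 f x = R x f - f"
  by (simp add: d0_def sum_form1_apply lmul_def xi_def sum_delta_mult del: minus_apply)

lemma tens_xi: "tens (xi a) (xi b) x y = (if x = a then if y = b then 1 else 0 else 0)"
  by (auto simp: tens_def xi_def R_def fun_eq_iff)

lemma nabla_xi_apply: "nabla_xi G x y z = - const (G x y z)"
proof -
  have "(\<Sum>a\<in>UNIV. \<Sum>b\<in>UNIV. lmul2 (const (G x a b)) (tens (xi a) (xi b))) y z
    = (\<Sum>a\<in>UNIV. \<Sum>b\<in>UNIV. if y = a then if z = b then const (G x a b) else 0 else 0)"
    unfolding sum_tensor_apply
    by (intro sum.cong) (auto simp: lmul2_def tens_xi)
  also have "\<dots> = (\<Sum>a\<in>UNIV. if y = a then const (G x a z) else 0)"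
    by (rule sum.cong) auto
  finally show ?thesis by (simp add: nabla_xi_def)
qed

lemma nabla_apply:
  "nabla G \<eta> y z = R y (\<eta> z) - \<eta> z - (\<Sum>x\<in>UNIV. \<eta> x * const (G x y z))"
proof -
  have 1: "tens (d0 (\<eta> x)) (xi x) y z = (R y (\<eta> x) - \<eta> x) * (if z = x then 1 else 0)" for x
    by (auto simp: tens_def xi_def d0_apply) (auto simp: R_def fun_eq_iff)
  show ?thesis
    by (simp add: nabla_def sum_tensor_apply 1 lmul2_def nabla_xi_apply sum_subtractf sum_delta_mult)
      (simp add: fun_eq_iff)
qed

lemma sigma_xi_apply:
  "sigma_xi G u v y z = (if perm_of y * perm_of z = perm_of u * perm_of v
     then const (G u y z + (if u = z then 1 else 0)) else 0)"
proof -
  let ?F = "\<lambda>p. const (G u (fst p) (snd p) + (if u = snd p then 1 else 0))"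
  have "sigma_xi G u v y z = (\<Sum>p \<in> {(y, z). perm_of y * perm_of z = perm_of u * perm_of v}.
      if (y, z) = p then ?F p else 0)"
    unfolding sigma_xi_def sum_tensor_apply
    by (rule sum.cong) (auto simp: lmul2_def tens_xi)
  then show ?thesis by (simp add: sum.delta)
qed

lemma exhaust_3: "x = 0 \<or> x = 1 \<or> x = 2" for x :: 3
proof (induct x)
  case (of_int z)
  then have "z = 0 \<or> z = 1 \<or> z = 2" by auto
  then show ?case by auto
qed

lemma perm_of_cases: "perm_of x \<in> {Perm.swap 0 1, Perm.swap 0 2, Perm.swap 1 2}"
proof -
  obtain i j where "i \<noteq> j" "perm_of x = Perm.swap i j" using perm_of[of x] by auto
  then show ?thesis
    using exhaust_3[of i] exhaust_3[of j] by (auto simp: swap_sym)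
qed

lemma triple: "\<exists>!v. perm_of u * perm_of v = perm_of y * perm_of z"
proof -
  have d: "(0::3) \<noteq> 1" "(0::3) \<noteq> 2" "(1::3) \<noteq> 2" by simp_all
  have eqI: "p = q" if "Perm.apply p 0 = Perm.apply q 0" "Perm.apply p 1 = Perm.apply q 1"
    "Perm.apply p 2 = Perm.apply q 2" for p q :: S3
    by (rule perm_eqI) (use that exhaust_3 in metis)
  let ?a = "Perm.swap 0 1 :: S3" and ?b = "Perm.swap 0 2 :: S3" and ?c = "Perm.swap 1 2 :: S3"
  have m: "?a * ?c = ?b * ?a" "?c * ?b = ?b * ?a" "?b * ?c = ?a * ?b" "?c * ?a = ?a * ?b"
    by (rule eqI; simp add: apply_times d d[symmetric])+
  have m2: "?a * (?b * ?a) = ?c" "?c * (?b * ?a) = ?b" "?b * (?a * ?b) = ?c" "?c * (?a * ?b) = ?a"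
    by (rule eqI; simp add: apply_times d d[symmetric])+
  have m3: "?a * (?a * ?b) = ?b" "?b * (?b * ?a) = ?a"
    by (simp_all flip: mult.assoc)
  have "perm_of u * (perm_of y * perm_of z) \<in> {?a, ?b, ?c}"
    using perm_of_cases[of u] perm_of_cases[of y] perm_of_cases[of z]
    by (elim insertE emptyE) (simp_all add: m m2 m3)
  then obtain v where "perm_of v = perm_of u * (perm_of y * perm_of z)"
    using d Abs_transposition_inverse[of "perm_of u * (perm_of y * perm_of z)"] by (smt (verit) insertE empty_iff mem_Collect_eq)
  then have v: "perm_of u * perm_of v = perm_of y * perm_of z"
    by (simp add: perm_of_square flip: mult.assoc)
  have "w = v" if "perm_of u * perm_of w = perm_of y * perm_of z" for w
  proof -
    have "perm_of u * (perm_of u * perm_of w) = perm_of u * (perm_of u * perm_of v)"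
      using v that by simp
    then show ?thesis by (simp add: perm_of_square perm_of_inject flip: mult.assoc)
  qed
  with v show ?thesis by blast
qed

text \<open>\<open>\<nabla>\<close> is a bimodule covariant derivative with \<open>\<sigma>\<close> as its generalised braiding.\<close>

lemma nabla_rmul: "nabla G (rmul \<eta> f) = rmul2 (nabla G \<eta>) f + sigma G (tens \<eta> (d0 f))"
proof (intro ext)
  fix y z g
  have 1: "(\<Sum>v\<in>UNIV. tens \<eta> (d0 f) u v * sigma_xi G u v y z)
     = \<eta> u * (R y (R z f) - R u f) * const (G u y z + (if u = z then 1 else 0))" for u
  proof -
    obtain v where v: "perm_of u * perm_of v = perm_of y * perm_of z"
      and v': "\<And>w. perm_of y * perm_of z = perm_of u * perm_of w \<longleftrightarrow> v = w"
      using triple[of u y z] by metis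
    have e: "tens \<eta> (d0 f) u v = \<eta> u * (R y (R z f) - R u f)"
      unfolding R_R v[symmetric] by (auto simp: tens_def d0_apply R_def fun_eq_iff mult.assoc)
    have "(\<Sum>w\<in>UNIV. tens \<eta> (d0 f) u w * sigma_xi G u w y z)
      = (\<Sum>w\<in>UNIV. if v = w then tens \<eta> (d0 f) u v * const (G u y z + (if u = z then 1 else 0)) else 0)"
      by (rule sum.cong) (auto simp: sigma_xi_apply v')
    then show ?thesis by (simp add: e)
  qed
  have 2: "sigma G (tens \<eta> (d0 f)) y z
     = (\<Sum>u\<in>UNIV. \<eta> u * (R y (R z f) - R u f) * const (G u y z + (if u = z then 1 else 0)))"
    by (simp add: sigma_def sum_tensor_apply lmul2_def 1)
  also have "\<dots> = (\<Sum>u\<in>UNIV. \<eta> u * (R y (R z f) - R u f) * const (G u y z)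
        + (\<eta> u * (R y (R z f) - R u f)) * (if z = u then 1 else 0))"
    by (rule sum.cong) (auto simp: const_def fun_eq_iff algebra_simps)
  also have "\<dots> = (\<Sum>u\<in>UNIV. \<eta> u * (R y (R z f) - R u f) * const (G u y z))
        + \<eta> z * (R y (R z f) - R z f)"
    by (simp only: sum.distrib sum_delta_mult)
  also have "(\<Sum>u\<in>UNIV. \<eta> u * (R y (R z f) - R u f) * const (G u y z))
      = (\<Sum>u\<in>UNIV. \<eta> u * const (G u y z)) * R y (R z f) - (\<Sum>u\<in>UNIV. \<eta> u * R u f * const (G u y z))"
    by (simp add: sum_distrib_left sum_subtractf algebra_simps)
  finally have 3: "sigma G (tens \<eta> (d0 f)) y z = \<dots> + \<eta> z * (R y (R z f) - R z f)" .
  have 4: "nabla G (rmul \<eta> f) y z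
    = R y (\<eta> z) * R y (R z f) - \<eta> z * R z f - (\<Sum>u\<in>UNIV. \<eta> u * R u f * const (G u y z))"
    unfolding nabla_apply by (auto simp: rmul_def R_def fun_eq_iff)
  have 5: "rmul2 (nabla G \<eta>) f y z = (R y (\<eta> z) - \<eta> z - (\<Sum>x\<in>UNIV. \<eta> x * const (G x y z))) * R y (R z f)"
    by (simp add: rmul2_def nabla_apply)
  show "nabla G (rmul \<eta> f) y z g = (rmul2 (nabla G \<eta>) f + sigma G (tens \<eta> (d0 f))) y z g"
    by (simp add: 3 4 5 algebra_simps)
qed


section \<open>The moduli space and its parametrization\<close>

definition hat_Gamma :: "complex \<Rightarrow> complex \<Rightarrow> complex \<Rightarrow> complex \<Rightarrow> complex \<Rightarrow> christoffel"
  where "hat_Gamma a b c d e x y z =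
    (if x = y \<and> y = z then a - 1
     else if y = z then b
     else if x = z then d - 1
     else if x = y then e
     else c)"

definition moduli :: "(complex \<times> complex \<times> complex \<times> complex \<times> complex) set"
  where "moduli = {(a, b, c, d, e).
    torsion_free (hat_Gamma a b c d e) \<and>
    cotorsion_free (hat_Gamma a b c d e) \<and>
    star_compatible (hat_Gamma a b c d e)}"

text \<open>The equations for \<open>cos \<theta>\<close>, \<open>cos (\<theta> - \<phi>)\<close> and \<open>cos \<psi>\<close> leave the signs of the three angles open.
  Those of \<open>\<theta>\<close> and \<open>\<psi>\<close> are not independent on the moduli space: torsion and cotorsion freeness
  together force \<open>b = c - 1\<close>, and for the values in \<open>params\<close> the imaginary part of this equation
  reads \<open>- r sin \<theta> = (2 / 3) sin \<psi> cos \<psi>\<close>, where \<open>cos \<psi> > 0\<close>.\<close>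

definition angles :: "real \<Rightarrow> real \<Rightarrow> real \<Rightarrow> real \<Rightarrow> bool"
  where "angles r \<theta> \<phi> \<psi> \<longleftrightarrow>
    \<bar>\<theta> - \<phi>\<bar> \<le> pi / 2 \<and> \<bar>\<psi>\<bar> \<le> pi / 2 \<and>
    cos \<theta> = (1 + 3 * r\<^sup>2) / (4 * r) \<and>
    cos (\<theta> - \<phi>) = r / (2 * sqrt (1 - 2 * r\<^sup>2)) \<and>
    cos \<psi> = sqrt (9 / 8 * (1 - r\<^sup>2))"

definition params :: "real \<Rightarrow> real \<Rightarrow> real \<Rightarrow> complex \<times> complex \<times> complex \<times> complex \<times> complex"
  where "params \<theta> \<phi> \<psi> =
    (let a = exp (\<i> * of_real \<phi>) / of_real (sqrt (1 + 8 * (cos (\<theta> - \<phi>))\<^sup>2));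
         b = - (exp (\<i> * of_real \<theta>) * of_real (2 * cos (\<theta> - \<phi>))
               / of_real (sqrt (1 + 8 * (cos (\<theta> - \<phi>))\<^sup>2)));
         c = 2 * exp (\<i> * of_real \<psi>) * of_real (cos \<psi>) / 3
     in (a, b, c, c, c - 1))"

end

theory Submission
  imports Defs
begin

text \<open>A tensor lies in \<open>ker (id - \<Psi>)\<close> iff its coefficients are constant on the two 3-cycles
  \<open>(x, y) \<rightarrow> (y, z) \<rightarrow> (z, x)\<close> of pairs of distinct transpositions. Torsion freeness therefore means
  \<open>d = c\<close>, \<open>e = c - 1\<close>, and cotorsion freeness then adds \<open>b = c - 1\<close>. The map \<open>\<sigma>\<close> preserves the
  product \<open>uv\<close>, so star compatibility is the unitarity of three circulant matrices, which leaves
  \<open>|a - b| = |a + 2 b| = |3 b + 2| = 1\<close>. With \<open>r = |b|\<close>, \<open>b = - r exp (\<i> \<theta>)\<close> and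
  \<open>a = |a| exp (\<i> \<phi>)\<close> these equations read \<open>|a|\<^sup>2 = 1 - 2 r\<^sup>2\<close>, \<open>r = 2 |a| cos (\<theta> - \<phi>)\<close> and
  \<open>4 r cos \<theta> = 1 + 3 r\<^sup>2\<close>; that both cosines are at most 1 bounds \<open>r\<close>.\<close>

section \<open>The three transpositions\<close>

lemma UNIV_transposition:
  assumes "x \<noteq> y" "y \<noteq> z" "x \<noteq> z"
  shows "(UNIV :: transposition set) = {x, y, z}"
proof -
  have "w = x \<or> w = y \<or> w = z" for w
    using assms perm_of_cases[of x] perm_of_cases[of y] perm_of_cases[of z] perm_of_cases[of w]
    unfolding perm_of_inject[symmetric] by auto
  then show ?thesis by blast
qed

lemma sum_transposition:
  assumes "x \<noteq> y" "y \<noteq> z" "x \<noteq> z"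
  shows "sum f (UNIV :: transposition set) = f x + (f y + f z)"
  using assms by (simp add: UNIV_transposition[OF assms])

lemma distinct_transpositions:
  obtains x y z :: transposition where "x \<noteq> y" "y \<noteq> z" "x \<noteq> z"
proof -
  have d: "(0::3) \<noteq> 1" "(0::3) \<noteq> 2" "(1::3) \<noteq> 2" by simp_all
  define f :: "3 \<Rightarrow> 3 \<Rightarrow> transposition" where "f i j = Abs_transposition (Perm.swap i j)" for i j
  have f: "perm_of (f i j) = Perm.swap i j" if "i \<noteq> j" for i j
    unfolding f_def by (rule Abs_transposition_inverse) (use that in blast)
  \<comment> \<open>The three transpositions are told apart by the images 1, 2, 0 of the point
    0.\<close>
  have app: "Perm.apply (perm_of (f 0 1)) 0 = 1" "Perm.apply (perm_of (f 0 2)) 0 = 2"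
    "Perm.apply (perm_of (f 1 2)) 0 = 0"
    using d by (simp_all add: f)
  show ?thesis
    by (rule that[of "f 0 1" "f 0 2" "f 1 2"]) (use app d in metis)+
qed

lemma third_transposition:
  obtains z :: transposition where "z \<noteq> x" "z \<noteq> y"
proof -
  obtain p q r :: transposition where "p \<noteq> q" "q \<noteq> r" "p \<noteq> r"
    by (rule distinct_transpositions)
  then have "\<exists>z. z \<noteq> x \<and> z \<noteq> y" by metis
  then show ?thesis using that by blast
qed

text \<open>Conjugating one transposition by another gives the third, so
  \<open>xy = y(yxy) = yz\<close>. Rotating the names, (x, y), (y, z), (z, x) are the three
  factorizations of one 3-cycle.\<close>

lemma perm_of_mult_cycle:
  assumes "x \<noteq> y" "y \<noteq> z" "x \<noteq> z"
  shows "perm_of x * perm_of y = perm_of y * perm_of z"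
proof -
  have d: "(0::3) \<noteq> 1" "(0::3) \<noteq> 2" "(1::3) \<noteq> 2" by simp_all
  have eqI: "p = q" if "Perm.apply p 0 = Perm.apply q 0" "Perm.apply p 1 = Perm.apply q 1"
    "Perm.apply p 2 = Perm.apply q 2" for p q :: S3
    by (rule perm_eqI) (use that exhaust_3 in metis)
  let ?a = "Perm.swap 0 1 :: S3" and ?b = "Perm.swap 0 2 :: S3" and ?c = "Perm.swap 1 2 :: S3"
  have "?a * ?b = ?b * ?c" "?b * ?c = ?c * ?a" "?c * ?a = ?a * ?b"
    "?b * ?a = ?a * ?c" "?a * ?c = ?c * ?b" "?c * ?b = ?b * ?a"
    by (rule eqI; simp add: apply_times d d[symmetric])+
  then show ?thesis
    using assms perm_of_cases[of x] perm_of_cases[of y] perm_of_cases[of z]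
    unfolding perm_of_inject[symmetric] by (elim insertE emptyE) simp_all
qed

text \<open>Cancellation in the group, oriented to simplify the guard of
  \<open>sigma_xi_apply\<close>: for a fixed first factor and a fixed target pair, exactly one
  second factor contributes.\<close>

lemma perm_of_mult_eq_iff:
  assumes "perm_of u * perm_of v = perm_of y * perm_of z"
  shows "perm_of y * perm_of z = perm_of u * perm_of w \<longleftrightarrow> w = v"
  using triple[of u y z] assms by metis

lemma conj_by_self: "conj_by x x = x"
  by (simp add: conj_by.rep_eq mult.assoc flip: perm_of_inject)

lemma conj_by_distinct:
  assumes "x \<noteq> y" "y \<noteq> z" "x \<noteq> z"
  shows "conj_by x y = z"
proof -
  have "perm_of x * perm_of y = perm_of z * perm_of x"
    using perm_of_mult_cycle[of x y z] perm_of_mult_cycle[of y z x] assms by simp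
  then show ?thesis
    by (simp add: conj_by.rep_eq mult.assoc flip: perm_of_inject)
qed


section \<open>The kernel of the wedge product\<close>

text \<open>\<open>Psi\<close> permutes the basis tensors: since \<open>conj_by y z = x\<close>, the
  one sent to the pair (x, y) is that of (y, z), while the pairs (x, x) are fixed.\<close>

lemma Psi_apply_self: "Psi T x x = T x x"
  and Psi_apply_distinct:
    "x \<noteq> y \<Longrightarrow> y \<noteq> z \<Longrightarrow> x \<noteq> z \<Longrightarrow> Psi T x y = T y z"
proof -
  have *: "Psi T x x = T x x" "Psi T x y = T y z" if n: "x \<noteq> y" "y \<noteq> z" "x \<noteq> z" for x y z
  proof -
    have "conj_by x y = z" "conj_by y x = z" "conj_by x z = y" "conj_by z x = y"
      "conj_by y z = x" "conj_by z y = x"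
      using n by (auto intro!: conj_by_distinct)
    then show "Psi T x x = T x x" "Psi T x y = T y z"
      unfolding Psi_def sum_tensor_apply sum_transposition[OF n]
      using n by (simp_all add: lmul2_def tens_xi conj_by_self)
  qed
  have "\<exists>y z. x \<noteq> y \<and> y \<noteq> z \<and> x \<noteq> z" by (metis third_transposition)
  with * show "Psi T x x = T x x" by blast
  show "x \<noteq> y \<Longrightarrow> y \<noteq> z \<Longrightarrow> x \<noteq> z \<Longrightarrow> Psi T x y = T y z"
    by (rule *)
qed

text \<open>The kernel consists of the tensors whose coefficients are fixed by the permutation
  \<open>Psi\<close>. Diagonal entries stay free; rotating x, y, z in the condition makes
  \<open>S\<close> constant on each 3-cycle of pairs.\<close>

lemma wedge_eq_0_iff:
  "wedge S = 0 \<longleftrightarrow> (\<forall>x y z. x \<noteq> y \<longrightarrow> y \<noteq> z \<longrightarrow> x \<noteq> z \<longrightarrow> S x y = S y z)"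
proof -
  have "wedge S = 0 \<longleftrightarrow> S - Psi S = 0"
    unfolding zero_form2_def by (simp add: form2.abs_eq_iff)
  also have "\<dots> \<longleftrightarrow> (\<forall>x y. S x y = Psi S x y)"
    by (auto simp: fun_eq_iff)
  also have "\<dots> \<longleftrightarrow> (\<forall>x y z. x \<noteq> y \<longrightarrow> y \<noteq> z \<longrightarrow> x \<noteq> z \<longrightarrow> S x y = S y z)"
  proof (intro iffI allI impI)
    fix x y z :: transposition
    assume "\<forall>x y. S x y = Psi S x y" "x \<noteq> y" "y \<noteq> z" "x \<noteq> z"
    then show "S x y = S y z" using Psi_apply_distinct[of x y z S] by metis
  next
    fix x y :: transposition
    assume a: "\<forall>x y z. x \<noteq> y \<longrightarrow> y \<noteq> z \<longrightarrow> x \<noteq> z \<longrightarrow> S x y = S y z"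
    obtain z where z: "z \<noteq> x" "z \<noteq> y" by (rule third_transposition[of x y])
    show "S x y = Psi S x y"
    proof (cases "x = y")
      case True
      then show ?thesis by (simp add: Psi_apply_self)
    next
      case False
      then show ?thesis using a z Psi_apply_distinct[of x y z S] by metis
    qed
  qed
  finally show ?thesis .
qed

section \<open>Torsion and cotorsion in terms of coefficients\<close>

lemma wedge_sum: "(\<Sum>i\<in>A. wedge (F i)) = wedge (\<Sum>i\<in>A. F i)"
proof (induction A rule: infinite_finite_induct)
  case (insert i A)
  then show ?case by (simp only: sum.insert[OF insert.hyps] plus_form2.abs_eq)
qed (simp_all only: sum.infinite not_False_eq_True sum.empty zero_form2_def)

lemma tens_xi_right: "tens \<eta> (xi z) p q = (if q = z then \<eta> p else 0)"
  by (auto simp: tens_def xi_def R_def fun_eq_iff)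

lemma theta_apply: "theta x = 1"
  by (simp add: theta_def sum_form1_apply xi_def)

lemma tens_xi_theta: "tens (xi z) theta p q = (if p = z then 1 else 0)"
  by (auto simp: tens_def xi_def R_def theta_apply fun_eq_iff)

lemma sum_form_delta:
  "(\<Sum>x\<in>(UNIV::transposition set). if z = x then F x else 0) = F z" for F :: form1
  by simp

text \<open>The derivative terms \<open>R y (\<eta> z)\<close> of \<open>nabla G \<eta>\<close> and
  \<open>d1 \<eta>\<close> cancel, so torsion is linear over the algebra.\<close>

lemma torsion_eq:
  "torsion G \<eta> = wedge (\<lambda>y z. - (\<Sum>x\<in>UNIV. \<eta> x * const (G x y z)) - \<eta> z - \<eta> y)"
proof -
  have "d1 \<eta> = wedge (\<Sum>x\<in>UNIV. tens (d0 (\<eta> x)) (xi x)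
      + lmul2 (\<eta> x) (tens theta (xi x) + tens (xi x) theta))"
    by (simp add: d1_def plus_form2.abs_eq wedge_sum)
  also have "(\<Sum>x\<in>UNIV. tens (d0 (\<eta> x)) (xi x)
      + lmul2 (\<eta> x) (tens theta (xi x) + tens (xi x) theta)) = (\<lambda>y z. R y (\<eta> z) + \<eta> y)"
  proof (intro ext)
    fix y z g
    have "(\<Sum>x\<in>UNIV. tens (d0 (\<eta> x)) (xi x)
        + lmul2 (\<eta> x) (tens theta (xi x) + tens (xi x) theta)) y z
      = (\<Sum>x\<in>UNIV. (if z = x then R y (\<eta> x) else 0) + (if y = x then \<eta> x else 0))"
      unfolding sum_tensor_apply
      by (rule sum.cong)
        (auto simp: tens_xi_right tens_xi_theta lmul2_def d0_apply theta_apply algebra_simps)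
    then show "(\<Sum>x\<in>UNIV. tens (d0 (\<eta> x)) (xi x)
        + lmul2 (\<eta> x) (tens theta (xi x) + tens (xi x) theta)) y z g = (R y (\<eta> z) + \<eta> y) g"
      by (simp only: sum.distrib sum_form_delta)
  qed
  finally have "torsion G \<eta> = wedge (nabla G \<eta> - (\<lambda>y z. R y (\<eta> z) + \<eta> y))"
    by (simp only: torsion_def minus_form2.abs_eq)
  also have "nabla G \<eta> - (\<lambda>y z. R y (\<eta> z) + \<eta> y)
    = (\<lambda>y z. - (\<Sum>x\<in>UNIV. \<eta> x * const (G x y z)) - \<eta> z - \<eta> y)"
    by (simp add: nabla_apply fun_eq_iff)
  finally show ?thesis .
qed

lemma torsion_free_hat_Gamma:
  "torsion_free (hat_Gamma a b c d e) \<longleftrightarrow> d = c \<and> e = c - 1"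
proof -
  define S where "S \<eta> y z = - (\<Sum>x\<in>UNIV. \<eta> x * const (hat_Gamma a b c d e x y z)) - \<eta> z - \<eta> y"
    for \<eta> :: form1 and y z
  \<comment> \<open>Passing from the pair (x, y) to (y, z) rotates the coefficients
    \<open>e + 1\<close>, \<open>d\<close>, \<open>c\<close> of \<open>\<eta> x\<close>,
    \<open>\<eta> y\<close>, \<open>\<eta> z\<close>, so both sides agree for every \<eta> exactly
    when these three coincide. \<open>a\<close> and \<open>b\<close> occur only on the diagonal,
    which the wedge product kills.\<close>
  have S: "S \<eta> x y = - (\<eta> x * const (e + 1) + \<eta> y * const d + \<eta> z * const c)"
    "S \<eta> y z = - (\<eta> x * const c + \<eta> y * const (e + 1) + \<eta> z * const d)"
    if "x \<noteq> y" "y \<noteq> z" "x \<noteq> z" for \<eta> x y z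
    unfolding S_def sum_transposition[OF that]
    using that by (auto simp: hat_Gamma_def const_def fun_eq_iff algebra_simps)
  have tf: "torsion_free (hat_Gamma a b c d e)
    \<longleftrightarrow> (\<forall>\<eta> x y z. x \<noteq> y \<longrightarrow> y \<noteq> z \<longrightarrow> x \<noteq> z \<longrightarrow> S \<eta> x y = S \<eta> y z)"
    unfolding torsion_free_def torsion_eq wedge_eq_0_iff S_def by blast
  show ?thesis
  proof
    assume l: "torsion_free (hat_Gamma a b c d e)"
    obtain x y z :: transposition where n: "x \<noteq> y" "y \<noteq> z" "x \<noteq> z"
      by (rule distinct_transpositions)
    \<comment> \<open>The two basis forms yield \<open>e + 1 = c\<close> and
      \<open>d = e + 1\<close>.\<close>
    have "S (xi x) x y 1 = S (xi x) y z 1" "S (xi y) x y 1 = S (xi y) y z 1"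
      using l n tf by metis+
    then show "d = c \<and> e = c - 1"
      using n by (simp add: S[OF n] xi_def const_def algebra_simps)
  next
    assume "d = c \<and> e = c - 1"
    then show "torsion_free (hat_Gamma a b c d e)"
      unfolding tf using S by (metis add.assoc diff_add_cancel)
  qed
qed

text \<open>Right translations fix constants, so the star only conjugates and negates the
  coefficients of \<open>Gamma G z x\<close>. The sum with \<open>Gamma G x z\<close> becomes a
  difference, to which \<open>wedge_eq_0_iff\<close> applies.\<close>

lemma cotorsion_free_iff:
  "cotorsion_free G \<longleftrightarrow> (\<forall>x p q r. p \<noteq> q \<longrightarrow> q \<noteq> r \<longrightarrow> p \<noteq> r \<longrightarrow>
     G x p q - cnj (G q p x) = G x q r - cnj (G r q x))"
proof -
  have Gamma: "Gamma G x z y = const (G x y z)" for x y z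
  proof -
    have "Gamma G x z y = (\<Sum>u\<in>UNIV. const (G x u z) * (if y = u then 1 else 0))"
      unfolding Gamma_def sum_form1_apply by (rule sum.cong) (auto simp: lmul_def xi_def)
    then show ?thesis by (simp only: sum_delta_mult)
  qed
  have st: "star1 (Gamma G z x) y = - const (cnj (G z y x))" for x y z
    by (simp add: star1_apply Gamma star0_def R_def const_def fun_eq_iff)
  have "(\<Sum>z\<in>UNIV. tens (Gamma G x z + star1 (Gamma G z x)) (xi z)) p q
    = const (G x p q - cnj (G q p x))" for x p q
    unfolding sum_tensor_apply
    by (simp add: tens_xi_right Gamma st) (simp add: const_def fun_eq_iff)
  then show ?thesis
    unfolding cotorsion_free_def wedge_sum wedge_eq_0_iff
    by (simp add: const_def fun_eq_iff)
qed

lemma cotorsion_free_hat_Gamma: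
  "cotorsion_free (hat_Gamma a b c d e) \<longleftrightarrow> e - cnj b = c - cnj c \<and> d - cnj d = c - cnj c"
  (is "?L \<longleftrightarrow> ?R")
proof
  assume l: ?L
  obtain p q r :: transposition where n: "p \<noteq> q" "q \<noteq> r" "p \<noteq> r"
    by (rule distinct_transpositions)
  have "\<forall>x. hat_Gamma a b c d e x p q - cnj (hat_Gamma a b c d e q p x)
      = hat_Gamma a b c d e x q r - cnj (hat_Gamma a b c d e r q x)"
    using l[unfolded cotorsion_free_iff] n by blast
  \<comment> \<open>The choices \<open>p\<close> and \<open>q\<close> for \<open>x\<close> already
    give both equations; the third choice \<open>r\<close> is a consequence of them.\<close>
  from spec[OF this, of p] spec[OF this, of q] show ?R
    using n by (simp add: hat_Gamma_def)
next
  assume r: ?R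
  show ?L
    unfolding cotorsion_free_iff
  proof (intro allI impI)
    fix x p q r :: transposition
    assume n: "p \<noteq> q" "q \<noteq> r" "p \<noteq> r"
    have "x \<in> {p, q, r}" using UNIV_transposition[OF n] by blast
    then show "hat_Gamma a b c d e x p q - cnj (hat_Gamma a b c d e q p x)
      = hat_Gamma a b c d e x q r - cnj (hat_Gamma a b c d e r q x)"
      using n r by (auto simp: hat_Gamma_def)
  qed
qed


section \<open>Star compatibility\<close>

text \<open>The pairs with product 1 are the diagonal ones, and the delta term of
  \<open>sigma_xi\<close> cancels the -1 in \<open>hat_Gamma\<close>. This leaves a circulant with
  \<open>a\<close> on the diagonal and \<open>b\<close> off it.\<close>

lemma sigma_apply_self:
  assumes n: "x \<noteq> y" "y \<noteq> z" "x \<noteq> z"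
  shows "sigma (hat_Gamma a b c d e) T x x g = a * T x x g + b * (T y y g + T z z g)"
proof -
  have "sigma_xi (hat_Gamma a b c d e) u v x x = (if v = u then const (if u = x then a else b) else 0)"
    for u v
  proof -
    have "perm_of u * perm_of u = perm_of x * perm_of x" by (simp add: perm_of_square)
    from perm_of_mult_eq_iff[OF this, of v] show ?thesis
      by (auto simp: sigma_xi_apply hat_Gamma_def const_def fun_eq_iff)
  qed
  then show ?thesis
    unfolding sigma_def sum_tensor_apply sum_transposition[OF n]
    using n by (simp add: lmul2_def const_def algebra_simps)
qed

text \<open>The three pairs of a cycle share one product, so \<sigma> mixes only these, by a
  circulant with entries \<open>e\<close>, \<open>d\<close>, \<open>c\<close>. For
  \<open>d = c\<close> it has the same shape as the diagonal block.\<close>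

lemma sigma_apply_distinct:
  assumes n: "x \<noteq> y" "y \<noteq> z" "x \<noteq> z"
  shows "sigma (hat_Gamma a b c d e) T x y g = e * T x y g + d * T y z g + c * T z x g"
proof -
  have p: "perm_of y * perm_of z = perm_of x * perm_of y"
    "perm_of z * perm_of x = perm_of x * perm_of y"
    using perm_of_mult_cycle[of x y z] perm_of_mult_cycle[of y z x] n by simp_all
  have "sigma_xi (hat_Gamma a b c d e) x v x y = (if v = y then const e else 0)"
    "sigma_xi (hat_Gamma a b c d e) y v x y = (if v = z then const d else 0)"
    "sigma_xi (hat_Gamma a b c d e) z v x y = (if v = x then const c else 0)" for v
    using n perm_of_mult_eq_iff[OF refl, of x y v]
      perm_of_mult_eq_iff[OF p(1), of v] perm_of_mult_eq_iff[OF p(2), of v]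
    by (auto simp: sigma_xi_apply hat_Gamma_def const_def fun_eq_iff)
  then show ?thesis
    unfolding sigma_def sum_tensor_apply sum_transposition[OF n]
    using n by (simp add: lmul2_def const_def algebra_simps)
qed

lemma tau_eval: "tau T x y g = cnj (T y x (g * (perm_of x * perm_of y)))"
  by (simp add: tau_apply R_R star0_def)

lemma bij_tau: "bij tau"
proof -
  have "tau (tau T) = T" for T
  proof -
    have "g * perm_of x * perm_of y * perm_of y * perm_of x = g" for g x y
      by (metis mult.assoc mult.right_neutral perm_of_square)
    then show ?thesis by (simp add: fun_eq_iff tau_eval flip: mult.assoc)
  qed
  then show ?thesis by (rule involuntory_imp_bij)
qed

text \<open>The equation implies bijectivity: as \<open>tau\<close> is bijective, the inner factor
  \<sigma> must be injective and the outer one surjective.\<close>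

lemma star_compatible_iff: "star_compatible G \<longleftrightarrow> (\<forall>T. sigma G (tau (sigma G T)) = tau T)"
proof
  show "star_compatible G" if "\<forall>T. sigma G (tau (sigma G T)) = tau T"
  proof -
    have eq: "sigma G \<circ> tau \<circ> sigma G = tau"
      using that by (simp add: fun_eq_iff)
    have "inj (sigma G)"
      using bij_tau unfolding bij_def by (metis eq inj_on_imageI2)
    moreover have "surj (sigma G)"
      using bij_tau unfolding bij_def by (metis eq comp_apply surj_def)
    ultimately show ?thesis using eq by (simp add: star_compatible_def bij_def)
  qed
qed (metis star_compatible_def comp_apply)

text \<open>On each of the three classes \<open>uv = const\<close> the map \<open>\<sigma>\<close> acts through a matrix \<open>\<alpha> I + \<beta> (J - I)\<close>,
  where \<open>J\<close> is the all-ones matrix. It is unitary iff its eigenvalues \<open>\<alpha> + 2 \<beta>\<close> and \<open>\<alpha> - \<beta>\<close> lie on the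
  unit circle.\<close>

lemma circulant_unitary:
  fixes \<alpha> \<beta> :: complex
  assumes "cmod (\<alpha> - \<beta>) = 1" "cmod (\<alpha> + 2 * \<beta>) = 1"
  shows "\<alpha> * cnj (\<alpha> * x + \<beta> * (y + z)) + \<beta> * (cnj (\<alpha> * y + \<beta> * (x + z)) + cnj (\<alpha> * z + \<beta> * (x + y)))
    = cnj x"
proof -
  have "(\<alpha> - \<beta>) * (cnj \<alpha> - cnj \<beta>) = 1" "(\<alpha> + 2 * \<beta>) * (cnj \<alpha> + 2 * cnj \<beta>) = 1"
    using assms complex_norm_square[of "\<alpha> - \<beta>"] complex_norm_square[of "\<alpha> + 2 * \<beta>"] by simp_all
  then have "\<alpha> * cnj \<alpha> + 2 * \<beta> * cnj \<beta> = 1" "\<alpha> * cnj \<beta> + \<beta> * cnj \<alpha> + \<beta> * cnj \<beta> = 0"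
    by algebra+
  then show ?thesis
    by (simp only: complex_cnj_add complex_cnj_mult) algebra
qed

lemma unitary_circulant:
  fixes \<alpha> \<beta> :: complex
  assumes "\<alpha> * cnj \<alpha> + 2 * (\<beta> * cnj \<beta>) = 1" "\<alpha> * cnj \<beta> + \<beta> * cnj \<alpha> + \<beta> * cnj \<beta> = 0"
  shows "cmod (\<alpha> - \<beta>) = 1" "cmod (\<alpha> + 2 * \<beta>) = 1"
proof -
  \<comment> \<open>The squared moduli are the first assumption minus the second, and the first plus
    twice the second.\<close>
  have "(\<alpha> - \<beta>) * cnj (\<alpha> - \<beta>) = 1" "(\<alpha> + 2 * \<beta>) * cnj (\<alpha> + 2 * \<beta>) = 1"
    using assms by (simp only: complex_cnj_add complex_cnj_diff complex_cnj_mult complex_cnj_numeral, algebra)+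
  then show "cmod (\<alpha> - \<beta>) = 1" "cmod (\<alpha> + 2 * \<beta>) = 1"
    by (simp_all only: of_real_eq_1_iff flip: complex_norm_square)
      (simp_all add: power2_eq_1_iff, (smt (verit) norm_ge_zero)+)
qed

lemma star_compatible_hat_Gamma:
  "star_compatible (hat_Gamma a b c c e) \<longleftrightarrow>
     cmod (a - b) = 1 \<and> cmod (a + 2 * b) = 1 \<and> cmod (e - c) = 1 \<and> cmod (e + 2 * c) = 1"
  (is "?L \<longleftrightarrow> ?R")
proof -
  let ?s = "sigma (hat_Gamma a b c c e)"
  \<comment> \<open>\<open>tau\<close> reverses each pair, hence exchanges the two 3-cycles, and
    moves the base point by the product of the pair. All pairs of a cycle share that product, so the
    single point \<open>h\<close> suffices.\<close>
  have off: "?s (tau (?s T)) x y g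
      = e * cnj (e * T y x h + c * (T x z h + T z y h))
      + c * (cnj (e * T z y h + c * (T y x h + T x z h)) + cnj (e * T x z h + c * (T y x h + T z y h)))"
    if n: "x \<noteq> y" "y \<noteq> z" "x \<noteq> z" and h: "h = g * (perm_of x * perm_of y)" for T x y z g h
  proof -
    have p: "perm_of y * perm_of z = perm_of x * perm_of y"
      "perm_of z * perm_of x = perm_of x * perm_of y"
      using perm_of_mult_cycle[of x y z] perm_of_mult_cycle[of y z x] n by simp_all
    have s: "?s T y x h = e * T y x h + c * T x z h + c * T z y h"
      "?s T z y h = e * T z y h + c * T y x h + c * T x z h"
      "?s T x z h = e * T x z h + c * T z y h + c * T y x h"
      using n by (auto intro!: sigma_apply_distinct)
    show ?thesis
      unfolding sigma_apply_distinct[OF n] tau_eval p h[symmetric] s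
      by (simp add: algebra_simps)
  qed
  have diag: "?s (tau (?s T)) x x g
      = a * cnj (a * T x x g + b * (T y y g + T z z g))
      + b * (cnj (a * T y y g + b * (T x x g + T z z g)) + cnj (a * T z z g + b * (T x x g + T y y g)))"
    if n: "x \<noteq> y" "y \<noteq> z" "x \<noteq> z" for T x y z g
  proof -
    have s: "?s T x x g = a * T x x g + b * (T y y g + T z z g)"
      "?s T y y g = a * T y y g + b * (T x x g + T z z g)"
      "?s T z z g = a * T z z g + b * (T x x g + T y y g)"
      using n by (auto intro!: sigma_apply_self)
    show ?thesis
      unfolding sigma_apply_self[OF n] tau_eval perm_of_square mult_1_right s by simp
  qed
  show ?thesis
  proof
    assume ?L
    then have eq: "?s (tau (?s T)) = tau T" for T by (simp add: star_compatible_iff)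
    obtain x y z :: transposition where n: "x \<noteq> y" "y \<noteq> z" "x \<noteq> z"
      by (rule distinct_transpositions)
    \<comment> \<open>Basis tensors as test inputs read off the entries of the unitarity
      relations.\<close>
    note d = diag[OF n, of "tens (xi u) (xi u)" 1 for u, unfolded eq tau_eval tens_xi]
    note o = off[OF n refl, of "tens (xi u) (xi v)" 1 for u v, unfolded eq tau_eval tens_xi]
    have "a * cnj a + 2 * (b * cnj b) = 1" "a * cnj b + b * cnj a + b * cnj b = 0"
      using d[of x] d[of y] n by (simp_all add: algebra_simps)
    moreover have "e * cnj e + 2 * (c * cnj c) = 1" "e * cnj c + c * cnj e + c * cnj c = 0"
      using o[of y x] o[of x z] n by (simp_all add: algebra_simps)
    ultimately show ?R by (simp add: unitary_circulant)
  next
    assume r: ?R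
    show ?L
      unfolding star_compatible_iff
    proof (intro allI ext)
      fix T x y g
      show "?s (tau (?s T)) x y g = tau T x y g"
      proof (cases "x = y")
        case True
        obtain u where u: "u \<noteq> x" by (metis third_transposition)
        obtain v where v: "v \<noteq> x" "v \<noteq> u" by (rule third_transposition[of x u])
        show ?thesis
          using diag[of x u v T g] circulant_unitary[of a b "T x x g"] r u v True
          by (auto simp: tau_eval perm_of_square)
      next
        case False
        obtain z where "z \<noteq> x" "z \<noteq> y" by (rule third_transposition[of x y])
        then show ?thesis
          using off[OF False _ _ refl, of z T g] r
            circulant_unitary[of e c "T y x (g * (perm_of x * perm_of y))"
              "T x z (g * (perm_of x * perm_of y))" "T z y (g * (perm_of x * perm_of y))"]
          by (auto simp: tau_eval algebra_simps)
      qed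
    qed
  qed
qed

text \<open>Torsion freeness gives \<open>e - c = - 1\<close>, so the modulus condition on
  \<open>e - c\<close> holds automatically. Cotorsion freeness reduces to the conjugate of
  \<open>b = c - 1\<close>, and then \<open>e + 2 * c = 3 * b + 2\<close>.\<close>

lemma moduli_iff:
  "(a, b, c, d, e) \<in> moduli \<longleftrightarrow> d = c \<and> e = c - 1 \<and> b = c - 1 \<and>
     cmod (a - b) = 1 \<and> cmod (a + 2 * b) = 1 \<and> cmod (3 * b + 2) = 1"
proof (cases "d = c \<and> e = c - 1")
  case True
  have "c - 1 - cnj b = c - cnj c \<longleftrightarrow> b = c - 1"
    by (metis (no_types, lifting) complex_cnj_cnj complex_cnj_diff complex_cnj_one diff_add_cancel
      diff_diff_eq2 add.commute diff_eq_eq)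
  moreover have "c - 1 + 2 * c = 3 * (c - 1) + 2" by simp
  ultimately show ?thesis
    using True by (auto simp: moduli_def torsion_free_hat_Gamma cotorsion_free_hat_Gamma
      star_compatible_hat_Gamma)
qed (auto simp: moduli_def torsion_free_hat_Gamma)


section \<open>The parametrization\<close>

text \<open>Law of cosines. Amplitudes may be negative, so \<open>rcis (- r) \<theta>\<close> can
  absorb the sign of \<open>b\<close>.\<close>

lemma cmod_rcis_add:
  "(cmod (rcis x \<phi> + rcis y \<theta>))\<^sup>2 = x\<^sup>2 + y\<^sup>2 + 2 * x * y * cos (\<theta> - \<phi>)"
proof -
  have "(cmod (rcis x \<phi> + rcis y \<theta>))\<^sup>2
    = (x * cos \<phi> + y * cos \<theta>)\<^sup>2 + (x * sin \<phi> + y * sin \<theta>)\<^sup>2"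
    by (simp add: cmod_power2)
  also have "\<dots> = x\<^sup>2 * ((cos \<phi>)\<^sup>2 + (sin \<phi>)\<^sup>2) + y\<^sup>2 * ((cos \<theta>)\<^sup>2 + (sin \<theta>)\<^sup>2)
      + 2 * x * y * (cos \<theta> * cos \<phi> + sin \<theta> * sin \<phi>)"
    by algebra
  finally show ?thesis by (simp add: cos_diff)
qed

lemma cmod_rcis_add_eq_1_iff:
  "cmod (rcis x \<phi> + rcis y \<theta>) = 1 \<longleftrightarrow> x\<^sup>2 + y\<^sup>2 + 2 * x * y * cos (\<theta> - \<phi>) = 1"
  unfolding cmod_rcis_add[symmetric] power2_eq_1_iff by (smt (verit) norm_ge_zero)

lemma abs_le_pi_half:
  assumes "\<bar>t\<bar> \<le> pi" "0 \<le> cos t"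
  shows "\<bar>t\<bar> \<le> pi / 2"
  using arccos_cos_eq_abs[OF assms(1)] arccos_le_pi2[OF assms(2)] by simp

text \<open>With \<open>k = sqrt (1 - 2 * r\<^sup>2)\<close> the radicand is
  \<open>(k\<^sup>2 + 2 * r\<^sup>2) / k\<^sup>2 = 1 / k\<^sup>2\<close>, so the amplitudes of
  \<open>a\<close> and \<open>b\<close> are \<open>k\<close> and \<open>- r\<close>.\<close>

lemma params_eq:
  assumes "angles r \<theta> \<phi> \<psi>" "2 * r\<^sup>2 < 1"
  shows "params \<theta> \<phi> \<psi> = (rcis (sqrt (1 - 2 * r\<^sup>2)) \<phi>, rcis (- r) \<theta>,
    rcis (2 / 3 * cos \<psi>) \<psi>, rcis (2 / 3 * cos \<psi>) \<psi>, rcis (2 / 3 * cos \<psi>) \<psi> - 1)"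
proof -
  define k where "k = sqrt (1 - 2 * r\<^sup>2)"
  have k: "k > 0" "k\<^sup>2 = 1 - 2 * r\<^sup>2" using assms(2) by (simp_all add: k_def)
  have c: "cos (\<theta> - \<phi>) = r / (2 * k)" using assms(1) by (simp add: angles_def k_def)
  have "1 + 8 * (cos (\<theta> - \<phi>))\<^sup>2 = (1 / k)\<^sup>2"
    unfolding c using k by (simp add: field_simps)
  then have "sqrt (1 + 8 * (cos (\<theta> - \<phi>))\<^sup>2) = 1 / k"
    using k(1) by (simp only: real_sqrt_abs) simp
  then show ?thesis
    using k(1) by (simp add: params_def Let_def c rcis_def cis_conv_exp flip: k_def)
qed

lemma params_in_moduli:
  assumes ang: "angles r \<theta> \<phi> \<psi>" and r: "1/3 \<le> r" "r \<le> 2/3" and s: "sin \<theta> * sin \<psi> \<le> 0"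
  shows "params \<theta> \<phi> \<psi> \<in> moduli"
proof -
  have r2: "r\<^sup>2 \<le> (2/3)\<^sup>2" by (rule power_mono) (use r in auto)
  then have r2': "2 * r\<^sup>2 < 1" by (simp add: power2_eq_square)
  define k where "k = sqrt (1 - 2 * r\<^sup>2)"
  have k: "k > 0" "k\<^sup>2 = 1 - 2 * r\<^sup>2" using r2' by (simp_all add: k_def)
  have c\<theta>: "r * cos \<theta> = (1 + 3 * r\<^sup>2) / 4" and c\<delta>: "k * cos (\<theta> - \<phi>) = r / 2"
    using ang r k(1) by (simp_all add: angles_def k_def)
  have c\<psi>: "(cos \<psi>)\<^sup>2 = 9 / 8 * (1 - r\<^sup>2)" "0 \<le> cos \<psi>"
    using ang r2' by (simp_all add: angles_def)
  let ?a = "rcis k \<phi>" and ?b = "rcis (- r) \<theta>" and ?c = "rcis (2 / 3 * cos \<psi>) \<psi>"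
  \<comment> \<open>Imaginary part of \<open>b = c - 1\<close>: both squares equal
    \<open>(1 - r\<^sup>2) * (9 * r\<^sup>2 - 1) / 16\<close>, and assumption \<open>s\<close> makes
    the signs agree.\<close>
  have "- r * sin \<theta> = 2 / 3 * cos \<psi> * sin \<psi>"
  proof -
    have "(- r * sin \<theta>)\<^sup>2 = r\<^sup>2 - (r * cos \<theta>)\<^sup>2"
      by (simp add: power_mult_distrib sin_squared_eq algebra_simps)
    also have "\<dots> = 4 / 9 * (cos \<psi>)\<^sup>2 * (1 - (cos \<psi>)\<^sup>2)"
      unfolding c\<theta> c\<psi> by (simp add: field_simps power2_eq_square)
    also have "\<dots> = (2 / 3 * cos \<psi> * sin \<psi>)\<^sup>2"
      unfolding sin_squared_eq[symmetric] by (simp add: power_mult_distrib power2_eq_square)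
    finally have sq: "(- r * sin \<theta>)\<^sup>2 = (2 / 3 * cos \<psi> * sin \<psi>)\<^sup>2" .
    have "(r * cos \<psi>) * (sin \<theta> * sin \<psi>) \<le> 0"
      by (rule mult_nonneg_nonpos) (use s c\<psi>(2) r in auto)
    then have "0 \<le> (- r * sin \<theta>) * (2 / 3 * cos \<psi> * sin \<psi>)"
      by (simp add: algebra_simps)
    with sq show ?thesis by (smt (verit) power2_eq_iff mult_minus_right zero_le_square mult_eq_0_iff
      power2_eq_square power_eq_0_iff)
  qed
  moreover have "2 / 3 * cos \<psi> * cos \<psi> - 1 = - r * cos \<theta>"
    using c\<theta> c\<psi>(1) by (simp add: power2_eq_square)
  ultimately have "?b = ?c - 1"
    by (simp add: complex_eq_iff)
  moreover have "cmod (?a - ?b) = 1"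
  proof -
    have "?a - ?b = rcis k \<phi> + rcis r \<theta>" by (simp add: rcis_def)
    moreover have "k\<^sup>2 + r\<^sup>2 + 2 * k * r * cos (\<theta> - \<phi>) = 1"
      using k(2) c\<delta> by algebra
    ultimately show ?thesis by (simp only: cmod_rcis_add_eq_1_iff)
  qed
  moreover have "cmod (?a + 2 * ?b) = 1"
  proof -
    have "?a + 2 * ?b = rcis k \<phi> + rcis (- 2 * r) \<theta>" by (simp add: rcis_def)
    moreover have "k\<^sup>2 + (- 2 * r)\<^sup>2 + 2 * k * (- 2 * r) * cos (\<theta> - \<phi>) = 1"
      using k(2) c\<delta> by algebra
    ultimately show ?thesis by (simp only: cmod_rcis_add_eq_1_iff)
  qed
  moreover have "cmod (3 * ?b + 2) = 1"
  proof -
    have "3 * ?b + 2 = rcis 2 0 + rcis (- 3 * r) \<theta>" by (simp add: rcis_def)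
    moreover have "2\<^sup>2 + (- 3 * r)\<^sup>2 + 2 * 2 * (- 3 * r) * cos (\<theta> - 0) = 1"
      using c\<theta> by (simp add: field_simps power2_eq_square)
    ultimately show ?thesis by (simp only: cmod_rcis_add_eq_1_iff)
  qed
  ultimately show ?thesis
    unfolding params_eq[OF ang r2'] k_def[symmetric] moduli_iff by blast
qed

lemma moduli_in_params:
  assumes m: "(a, b, c, d, e) \<in> moduli"
  shows "\<exists>r\<in>{1/3..2/3}. \<exists>\<theta> \<phi> \<psi>.
    angles r \<theta> \<phi> \<psi> \<and> sin \<theta> * sin \<psi> \<le> 0 \<and> (a, b, c, d, e) = params \<theta> \<phi> \<psi>"
proof -
  have dce: "d = c" "e = c - 1" "b = c - 1"
    and u: "cmod (a - b) = 1" "cmod (a + 2 * b) = 1" "cmod (3 * b + 2) = 1"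
    using m unfolding moduli_iff by blast+
  \<comment> \<open>\<open>a = 0\<close> would force both \<open>cmod b = 1\<close> and
    \<open>2 * cmod b = 1\<close>.\<close>
  have a0: "a \<noteq> 0" using u(1,2) by (auto simp: norm_mult)
  have b0: "b \<noteq> 0" using u(3) by auto
  define r where "r = cmod b"
  define k where "k = cmod a"
  define \<theta> where "\<theta> = Arg (- b)"
  \<comment> \<open>Taking \<theta> - \<phi> itself as a principal argument, and \<phi> from it,
    keeps this difference within \<pi> in absolute value.\<close>
  define \<delta> where "\<delta> = Arg (- b / a)"
  define \<phi> where "\<phi> = \<theta> - \<delta>"
  have pos: "r > 0" "k > 0" using a0 b0 by (simp_all add: r_def k_def)
  have b: "- b = rcis r \<theta>" unfolding r_def \<theta>_def by (metis norm_minus_cancel rcis_cmod_Arg)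
  then have b': "b = rcis (- r) \<theta>" by (simp add: rcis_def) (metis minus_minus)
  have "- b / a = rcis (r / k) \<delta>"
    unfolding r_def k_def \<delta>_def by (metis norm_minus_cancel norm_divide rcis_cmod_Arg)
  then have "a = rcis r \<theta> / rcis (r / k) \<delta>"
    using a0 b0 b by (metis divide_divide_eq_right neg_equal_0_iff_equal nonzero_mult_div_cancel_left)
  then have a: "a = rcis k \<phi>"
    using pos by (simp add: rcis_divide \<phi>_def)
  have sums: "a - b = rcis k \<phi> + rcis r \<theta>" "a + 2 * b = rcis k \<phi> + rcis (- 2 * r) \<theta>"
    "3 * b + 2 = rcis 2 0 + rcis (- 3 * r) \<theta>"
    unfolding a b' by (simp_all add: rcis_def)
  have eq: "k\<^sup>2 + r\<^sup>2 + 2 * k * r * cos \<delta> = 1"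
    "k\<^sup>2 + (- 2 * r)\<^sup>2 + 2 * k * (- 2 * r) * cos \<delta> = 1"
    "2\<^sup>2 + (- 3 * r)\<^sup>2 + 2 * 2 * (- 3 * r) * cos \<theta> = 1"
    using u unfolding sums cmod_rcis_add_eq_1_iff by (simp_all add: \<phi>_def)
  have k2: "k\<^sup>2 = 1 - 2 * r\<^sup>2" using eq(1,2) by (simp add: power2_eq_square)
  have "r * r = r * (2 * k * cos \<delta>)" using eq(1,2) by algebra
  then have c\<delta>: "r = 2 * k * cos \<delta>" using pos by simp
  have c\<theta>: "r * cos \<theta> = (1 + 3 * r\<^sup>2) / 4" using eq(3) by (simp add: power2_eq_square)
  \<comment> \<open>\<open>cos \<delta> \<le> 1\<close> gives \<open>r \<le> 2 * k\<close>, that is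
    \<open>9 * r\<^sup>2 \<le> 4\<close>.\<close>
  have r_le: "r \<le> 2 / 3"
  proof -
    have "r \<le> 2 * k" using c\<delta> pos mult_left_mono[OF cos_le_one[of \<delta>], of "2 * k"] by simp
    then have "r\<^sup>2 \<le> (2 * k)\<^sup>2" using pos by (intro power_mono) auto
    then have "r\<^sup>2 \<le> (2 / 3)\<^sup>2" using k2 by (simp add: power_mult_distrib power2_eq_square)
    then show ?thesis by (rule power2_le_imp_le) simp
  qed
  \<comment> \<open>\<open>cos \<theta> \<le> 1\<close> gives
    \<open>(1 - 3 * r) * (1 - r) \<le> 0\<close>.\<close>
  have r_ge: "1 / 3 \<le> r"
  proof (rule ccontr)
    assume "\<not> 1 / 3 \<le> r"
    then have "0 < (1 - 3 * r) * (1 - r)" by (intro mult_pos_pos) auto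
    moreover have "r * cos \<theta> \<le> r" using pos mult_left_mono[OF cos_le_one[of \<theta>], of r] by simp
    ultimately show False using c\<theta> by (simp add: algebra_simps power2_eq_square)
  qed
  have r2: "r\<^sup>2 \<le> (2/3)\<^sup>2" by (rule power_mono) (use r_le pos in auto)
  then have r2': "2 * r\<^sup>2 < 1" by (simp add: power2_eq_square)
  define \<psi> where "\<psi> = Arg c"
  define m where "m = cmod c"
  have c: "c = rcis m \<psi>" by (simp add: m_def \<psi>_def rcis_cmod_Arg)
  have Re_c: "m * cos \<psi> = 3 / 4 * (1 - r\<^sup>2)" and Im_c: "m * sin \<psi> = - r * sin \<theta>"
  proof -
    have "Re c = Re b + 1" "Im c = Im b" using dce by simp_all
    then show "m * cos \<psi> = 3 / 4 * (1 - r\<^sup>2)" "m * sin \<psi> = - r * sin \<theta>"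
      using c\<theta> unfolding b' c by (simp_all add: field_simps)
  qed
  have m_pos: "m > 0" using Re_c r2' by (cases "m = 0") (auto simp: m_def)
  \<comment> \<open>The condition \<open>cmod (3 * c - 1) = 1\<close> describes the circle through 0
    with centre 1/3, whose polar equation this is.\<close>
  have m: "m = 2 / 3 * cos \<psi>"
  proof -
    have "rcis (- 1) 0 + rcis (3 * m) \<psi> = 3 * c - 1"
      using c by (simp add: rcis_def)
    also have "\<dots> = 3 * b + 2"
      using dce by simp
    finally have "(- 1)\<^sup>2 + (3 * m)\<^sup>2 + 2 * (- 1) * (3 * m) * cos (\<psi> - 0) = 1"
      using u(3) by (simp only: flip: cmod_rcis_add_eq_1_iff)
    then have "m * (3 * m) = m * (2 * cos \<psi>)" by (simp add: power2_eq_square)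
    then show ?thesis using m_pos by simp
  qed
  have "cos \<psi> = sqrt (9 / 8 * (1 - r\<^sup>2))"
    using Re_c m m_pos by (intro real_sqrt_unique[symmetric]) (simp_all add: power2_eq_square)
  moreover have "cos \<theta> = (1 + 3 * r\<^sup>2) / (4 * r)" using c\<theta> pos by (simp add: field_simps)
  moreover have "cos \<delta> = r / (2 * sqrt (1 - 2 * r\<^sup>2))"
    unfolding k2[symmetric] using c\<delta> pos by (simp add: field_simps)
  moreover have "\<bar>\<delta>\<bar> \<le> pi / 2" "\<bar>\<psi>\<bar> \<le> pi / 2"
  proof -
    have "0 \<le> cos \<delta>" "0 \<le> cos \<psi>"
      using c\<delta> pos m m_pos by (simp_all add: zero_less_mult_iff order.strict_implies_order)
    moreover have "\<bar>\<delta>\<bar> \<le> pi" "\<bar>\<psi>\<bar> \<le> pi"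
      using Arg_bounded[of "- b / a"] Arg_bounded[of c] by (auto simp: \<delta>_def \<psi>_def)
    ultimately show "\<bar>\<delta>\<bar> \<le> pi / 2" "\<bar>\<psi>\<bar> \<le> pi / 2" by (blast intro: abs_le_pi_half)+
  qed
  ultimately have ang: "angles r \<theta> \<phi> \<psi>" by (simp add: angles_def \<phi>_def)
  have "m * (sin \<theta> * sin \<psi>) = - r * (sin \<theta>)\<^sup>2" using Im_c by algebra
  also have "\<dots> \<le> 0" using pos by simp
  finally have "sin \<theta> * sin \<psi> \<le> 0" using m_pos by (simp add: mult_le_0_iff)
  moreover have "(a, b, c, d, e) = params \<theta> \<phi> \<psi>"
    unfolding params_eq[OF ang r2'] k2[symmetric] using dce a b' c m pos by simp
  moreover have "r \<in> {1/3..2/3}" using r_ge r_le by simp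
  ultimately show ?thesis using ang by blast
qed

text \<open>The angles are signed arccosines; \<psi> takes the sign \<open>- s\<close> because the
  imaginary part of \<open>b = c - 1\<close> opposes it to \<theta>. Continuity is that of arccos,
  whose arguments stay in [0, 1], and \<open>cmod b = r\<close> recovers the parameter.\<close>

lemma params_branch:
  fixes s t :: real
  assumes s: "s = - 1 \<or> s = 1" and t: "t = - 1 \<or> t = 1"
  shows "\<exists>\<theta> \<phi> \<psi> :: real \<Rightarrow> real.
         (\<forall>r\<in>{1/3..2/3}. angles r (\<theta> r) (\<phi> r) (\<psi> r) \<and> \<bar>\<theta> r\<bar> \<le> pi \<and>
            0 \<le> s * \<theta> r \<and> s * \<psi> r \<le> 0 \<and> 0 \<le> t * (\<theta> r - \<phi> r)) \<and>
         continuous_on {1/3..2/3} (\<lambda>r. params (\<theta> r) (\<phi> r) (\<psi> r)) \<and>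
         inj_on (\<lambda>r. params (\<theta> r) (\<phi> r) (\<psi> r)) {1/3..2/3}"
proof -
  define A where "A r = (1 + 3 * r\<^sup>2) / (4 * r)" for r :: real
  define B where "B r = r / (2 * sqrt (1 - 2 * r\<^sup>2))" for r :: real
  define C where "C r = sqrt (9 / 8 * (1 - r\<^sup>2))" for r :: real
  have r2: "2 * r\<^sup>2 < 1" "1 / 9 \<le> r\<^sup>2" "9 * r\<^sup>2 \<le> 4" if "r \<in> {1/3..2/3}" for r :: real
  proof -
    have "r\<^sup>2 \<le> (2/3)\<^sup>2" "(1/3)\<^sup>2 \<le> r\<^sup>2" using that by (auto intro!: power_mono)
    then show "2 * r\<^sup>2 < 1" "1 / 9 \<le> r\<^sup>2" "9 * r\<^sup>2 \<le> 4" by (simp_all add: power2_eq_square)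
  qed
  have A: "0 \<le> A r" "A r \<le> 1" if "r \<in> {1/3..2/3}" for r
  proof -
    \<comment> \<open>This product is the numerator of \<open>1 - A r\<close> over the denominator
      \<open>4 * r\<close>.\<close>
    have "0 \<le> (3 * r - 1) * (1 - r)" using that by (intro mult_nonneg_nonneg) auto
    then show "0 \<le> A r" "A r \<le> 1"
      using that by (auto simp: A_def field_simps power2_eq_square)
  qed
  have B: "0 \<le> B r" "B r \<le> 1" if "r \<in> {1/3..2/3}" for r
  proof -
    have "r\<^sup>2 \<le> (2 * sqrt (1 - 2 * r\<^sup>2))\<^sup>2"
      using r2[OF that] by (simp add: power_mult_distrib)
    then have "r \<le> 2 * sqrt (1 - 2 * r\<^sup>2)"
      by (rule power2_le_imp_le) (use r2[OF that] in simp)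
    then show "0 \<le> B r" "B r \<le> 1"
      using that r2[OF that] by (auto simp: B_def)
  qed
  have C: "0 \<le> C r" "C r \<le> 1" if "r \<in> {1/3..2/3}" for r
    using r2[OF that] by (auto simp: C_def)
  define \<theta> where "\<theta> r = s * arccos (A r)" for r
  define \<phi> where "\<phi> r = \<theta> r - t * arccos (B r)" for r
  define \<psi> where "\<psi> r = - s * arccos (C r)" for r
  have sgn: "cos (s * x) = cos x" "cos (t * x) = cos x" "\<bar>s * x\<bar> = \<bar>x\<bar>" "\<bar>t * x\<bar> = \<bar>x\<bar>"
    "s * (s * x) = x" "t * (t * x) = x" for x
    using s t by auto
  have ang: "angles r (\<theta> r) (\<phi> r) (\<psi> r) \<and> \<bar>\<theta> r\<bar> \<le> pi \<and>
            0 \<le> s * \<theta> r \<and> s * \<psi> r \<le> 0 \<and> 0 \<le> t * (\<theta> r - \<phi> r)" if r: "r \<in> {1/3..2/3}" for r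
  proof -
    have "0 \<le> arccos (A r)" "arccos (A r) \<le> pi / 2" "cos (arccos (A r)) = A r"
      "0 \<le> arccos (B r)" "arccos (B r) \<le> pi / 2" "cos (arccos (B r)) = B r"
      "0 \<le> arccos (C r)" "arccos (C r) \<le> pi / 2" "cos (arccos (C r)) = C r"
      using A[OF r] B[OF r] C[OF r] by (simp_all only: arccos_lbound arccos_le_pi2 cos_arccos order_trans[of "-1" 0] neg_le_0_iff_le zero_le_one)
    then show ?thesis
      unfolding angles_def A_def[symmetric] B_def[symmetric] C_def[symmetric]
      using pi_gt_zero by (simp add: \<theta>_def \<phi>_def \<psi>_def sgn)
  qed
  moreover have "continuous_on {1/3..2/3} (\<lambda>r. params (\<theta> r) (\<phi> r) (\<psi> r))"
  proof -
    have cA: "continuous_on {1/3..2/3} A"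
      unfolding A_def by (auto intro!: continuous_intros)
    have cB: "continuous_on {1/3..2/3} B"
      unfolding B_def using r2(1) by (auto intro!: continuous_intros) force
    have cC: "continuous_on {1/3..2/3} C"
      unfolding C_def by (auto intro!: continuous_intros)
    have c\<theta>: "continuous_on {1/3..2/3} \<theta>"
      unfolding \<theta>_def using A by (intro continuous_intros cA) force
    have c\<phi>: "continuous_on {1/3..2/3} \<phi>"
      unfolding \<phi>_def using B by (intro continuous_intros c\<theta> cB) force
    have c\<psi>: "continuous_on {1/3..2/3} \<psi>"
      unfolding \<psi>_def using C by (intro continuous_intros cC) force
    have "1 + 8 * (cos x)\<^sup>2 \<noteq> 0" for x :: real
      by (smt (verit) zero_le_power2)
    then show ?thesis
      unfolding params_def Let_def by (intro continuous_intros c\<theta> c\<phi> c\<psi>) simp_all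
  qed
  moreover have "inj_on (\<lambda>r. params (\<theta> r) (\<phi> r) (\<psi> r)) {1/3..2/3}"
  proof (rule inj_on_inverseI)
    fix r :: real assume r: "r \<in> {1/3..2/3}"
    show "(\<lambda>(a, b, c, d, e). cmod b) (params (\<theta> r) (\<phi> r) (\<psi> r)) = r"
      using r params_eq[OF _ r2(1)[OF r]] ang[OF r] by (simp add: complex_mod_rcis)
  qed
  ultimately show ?thesis by blast
qed

text \<open>The condition on \<open>sin \<theta> * sin \<psi>\<close> couples the two signs as
  \<open>b = c - 1\<close> demands. The second conjunct makes the single continuous parameter
  precise: \<open>s\<close> selects the sign of \<theta>, and with it that of \<psi>, and
  \<open>t\<close> selects the sign of \<theta> - \<phi>.\<close>

theorem proposition5p2p7:
  shows "moduli =
      {p. \<exists>r\<in>{1/3..2/3}. \<exists>\<theta> \<phi> \<psi>.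
         angles r \<theta> \<phi> \<psi> \<and> sin \<theta> * sin \<psi> \<le> 0 \<and> p = params \<theta> \<phi> \<psi>}
    \<and> (\<forall>s\<in>{-1, 1::real}. \<forall>t\<in>{-1, 1::real}. \<exists>\<theta> \<phi> \<psi> :: real \<Rightarrow> real.
         (\<forall>r\<in>{1/3..2/3}. angles r (\<theta> r) (\<phi> r) (\<psi> r) \<and> \<bar>\<theta> r\<bar> \<le> pi \<and>
            0 \<le> s * \<theta> r \<and> s * \<psi> r \<le> 0 \<and> 0 \<le> t * (\<theta> r - \<phi> r)) \<and>
         continuous_on {1/3..2/3} (\<lambda>r. params (\<theta> r) (\<phi> r) (\<psi> r)) \<and>
         inj_on (\<lambda>r. params (\<theta> r) (\<phi> r) (\<psi> r)) {1/3..2/3})"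
proof (intro conjI ballI)
  show "moduli =
      {p. \<exists>r\<in>{1/3..2/3}. \<exists>\<theta> \<phi> \<psi>.
         angles r \<theta> \<phi> \<psi> \<and> sin \<theta> * sin \<psi> \<le> 0 \<and> p = params \<theta> \<phi> \<psi>}" (is "_ = ?P")
  proof
    show "moduli \<subseteq> ?P" using moduli_in_params by (auto simp del: One_nat_def)
    show "?P \<subseteq> moduli" using params_in_moduli by auto
  qed
qed (rule params_branch, auto)

end
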